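(* Let $A,B$ be positive definite complex $n\times n$ matrices, let $0<\tau<1$ and $0\leq t\leq 1$. If $t\leq r(\tau)$ or $t\geq R(\tau)$, then $$!_t(A,B)+\frac{t(1-t)}{\tau(1-\tau)}\left[A\nabla B-!_{\tau}(A,B)\right]\leq A\nabla B.$$ If instead $r(\tau)\leq t\leq R(\tau)$, then the reversed inequality holds: $$!_t(A,B)+\frac{t(1-t)}{\tau(1-\tau)}\left[A\nabla B-!_{\tau}(A,B)\right]\geq A\nabla B.$$
   Context: For Hermitian matrices, $A\leq B$ means $B-A$ is positive semidefinite (Loewner order). For positive definite $A,B$ and $0\le t\le1$: $A!_tB=((1-t)A^{-1}+tB^{-1})^{-1}$, $A\nabla B=\frac{A+B}{2}$, and the harmonic Heinz mean is $!_t(A,B)=\frac{A!_tB+A!_{1-t}B}{2}$. For $0\le\tau\le1$, $r(\tau)=\min\{\tau,1-\tau\}$ and $R(\tau)=\max\{\tau,1-\tau\}$. *)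

theory Defs
  imports "HOL-Analysis.Analysis"
begin

definition conj_transpose :: "complex^'n^'m \<Rightarrow> complex^'m^'n" where
  "conj_transpose A = (\<chi> i j. cnj (A $ j $ i))"

definition hermitian_matrix :: "complex^'n^'n \<Rightarrow> bool" where
  "hermitian_matrix A \<longleftrightarrow> conj_transpose A = A"

text \<open>The quadratic form \<open>x* A x\<close>, which is real whenever \<open>A\<close> is Hermitian.\<close>

definition quad_form :: "complex^'n^'n \<Rightarrow> complex^'n \<Rightarrow> complex" where
  "quad_form A x = (\<Sum>i\<in>UNIV. cnj (x $ i) * (A *v x) $ i)"

definition pos_semidef :: "complex^'n^'n \<Rightarrow> bool" where
  "pos_semidef A \<longleftrightarrow> hermitian_matrix A \<and> (\<forall>x. Re (quad_form A x) \<ge> 0)"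

definition pos_def :: "complex^'n^'n \<Rightarrow> bool" where
  "pos_def A \<longleftrightarrow> hermitian_matrix A \<and> (\<forall>x. x \<noteq> 0 \<longrightarrow> Re (quad_form A x) > 0)"

text \<open>The order \<open>\<le>\<close> that the library puts on vectors, and hence on matrices, is the
  componentwise one, so the Loewner order gets its own symbol.\<close>

definition loewner_le :: "complex^'n^'n \<Rightarrow> complex^'n^'n \<Rightarrow> bool" (infix "\<preceq>\<^sub>L" 50) where
  "A \<preceq>\<^sub>L B \<longleftrightarrow> pos_semidef (B - A)"

definition harmonic_mean :: "real \<Rightarrow> complex^'n^'n \<Rightarrow> complex^'n^'n \<Rightarrow> complex^'n^'n" where
  "harmonic_mean t A B = matrix_inv ((1 - t) *\<^sub>R matrix_inv A + t *\<^sub>R matrix_inv B)"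

definition arithmetic_mean :: "complex^'n^'n \<Rightarrow> complex^'n^'n \<Rightarrow> complex^'n^'n" where
  "arithmetic_mean A B = (1/2) *\<^sub>R (A + B)"

definition harmonic_heinz_mean :: "real \<Rightarrow> complex^'n^'n \<Rightarrow> complex^'n^'n \<Rightarrow> complex^'n^'n" where
  "harmonic_heinz_mean t A B = (1/2) *\<^sub>R (harmonic_mean t A B + harmonic_mean (1 - t) A B)"

definition weight_min :: "real \<Rightarrow> real" where
  "weight_min \<tau> = min \<tau> (1 - \<tau>)"

definition weight_max :: "real \<Rightarrow> real" where
  "weight_max \<tau> = max \<tau> (1 - \<tau>)"

end

theory Submission
  imports Defs
begin

text \<open>
  With \<open>N = (A\<^sup>-\<^sup>1 + B\<^sup>-\<^sup>1)/2\<close> and \<open>E = (A\<^sup>-\<^sup>1 - B\<^sup>-\<^sup>1)/2\<close>, the two matrices that are inverted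
  in the Heinz mean at \<open>t\<close> are \<open>N + c E\<close> and \<open>N - c E\<close>, where \<open>c = 1 - 2 t\<close>.  The average of
  their inverses is again a single inverse, \<open>(N - c\<^sup>2 E N\<^sup>-\<^sup>1 E)\<^sup>-\<^sup>1\<close> (lemma
  \<open>matrix_inv_average\<close>).  So the Heinz mean is \<open>K u = (X u)\<^sup>-\<^sup>1\<close> at \<open>u = (1 - 2 t)\<^sup>2\<close>, where
  \<open>X u = N - u E N\<^sup>-\<^sup>1 E\<close> is affine in \<open>u\<close>, and the arithmetic mean, being the Heinz mean at
  \<open>t = 0\<close>, is \<open>K 1\<close>.

  Put \<open>v = (1 - 2 \<tau>)\<^sup>2\<close>.  Since \<open>1 - u = 4 t (1 - t)\<close>, the coefficient in the theorem is
  \<open>\<lambda> = (1 - u)/(1 - v)\<close>, the one for which \<open>u = (1 - \<lambda>) 1 + \<lambda> v\<close>.  The two inequalities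
  compare \<open>K u\<close> with \<open>(1 - \<lambda>) K 1 + \<lambda> K v\<close>, and both express that \<open>K\<close> is convex on \<open>[0, 1]\<close>:
  if \<open>t\<close> lies outside the interval between \<open>\<tau>\<close> and \<open>1 - \<tau>\<close>, then \<open>v \<le> u \<le> 1\<close>
  and \<open>K\<close> is interpolated at \<open>u\<close>; if \<open>t\<close> lies inside, then \<open>u \<le> v \<le> 1\<close> and \<open>K\<close> is interpolated
  at \<open>v\<close>.  Convexity of \<open>K\<close> is operator convexity of the inverse on positive definite
  matrices (lemma \<open>loewner_inverse_convex\<close>), which follows from the variational formula
  \<open>x* M\<^sup>-\<^sup>1 x = max\<^sub>y (2 Re (y* x) - y* M y)\<close>: a maximum of functions affine in \<open>M\<close> is convex.
\<close>

section \<open>Hermitian matrices and the real inner product\<close>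

text \<open>The real inner product of \<^typ>\<open>complex^'n\<close> is the real part of the Hermitian one, so the
  quadratic form can be handled with the library's real inner product.\<close>

lemma Re_quad_form: "Re (quad_form A x) = x \<bullet> (A *v x)"
  by (simp add: quad_form_def inner_vec_def inner_complex_def)

lemma conj_transpose_add: "conj_transpose (A + B) = conj_transpose A + conj_transpose B"
  by (simp add: conj_transpose_def vec_eq_iff)

lemma conj_transpose_diff: "conj_transpose (A - B) = conj_transpose A - conj_transpose B"
  by (simp add: conj_transpose_def vec_eq_iff)

lemma conj_transpose_scaleR: "conj_transpose (c *\<^sub>R A) = c *\<^sub>R conj_transpose A"
  by (simp add: conj_transpose_def vec_eq_iff)

lemma conj_transpose_mult:
  "conj_transpose (A ** B) = conj_transpose B ** conj_transpose A"
  by (simp add: conj_transpose_def vec_eq_iff matrix_matrix_mult_def mult.commute)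

lemma conj_transpose_mat_1: "conj_transpose (mat 1) = mat 1"
  by (auto simp: conj_transpose_def vec_eq_iff mat_def)

lemma hermitian_matrix_add:
  "hermitian_matrix A \<Longrightarrow> hermitian_matrix B \<Longrightarrow> hermitian_matrix (A + B)"
  by (simp add: hermitian_matrix_def conj_transpose_add)

lemma hermitian_matrix_diff:
  "hermitian_matrix A \<Longrightarrow> hermitian_matrix B \<Longrightarrow> hermitian_matrix (A - B)"
  by (simp add: hermitian_matrix_def conj_transpose_diff)

lemma hermitian_matrix_scaleR: "hermitian_matrix A \<Longrightarrow> hermitian_matrix (c *\<^sub>R A)"
  by (simp add: hermitian_matrix_def conj_transpose_scaleR)

lemma inner_matrix_conj_transpose: "(A *v x) \<bullet> y = x \<bullet> (conj_transpose A *v y)"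
proof -
  have inner: "a \<bullet> b = Re (\<Sum>i\<in>UNIV. cnj (a $ i) * b $ i)" for a b :: "complex^'k"
    by (simp add: inner_vec_def inner_complex_def)
  have "(A *v x) \<bullet> y = Re (\<Sum>i\<in>UNIV. \<Sum>j\<in>UNIV. cnj (A $ i $ j) * cnj (x $ j) * y $ i)"
    unfolding inner by (simp only: matrix_vector_mult_def vec_lambda_beta sum_distrib_right
        cnj_sum complex_cnj_mult)
  also have "\<dots> = Re (\<Sum>j\<in>UNIV. \<Sum>i\<in>UNIV. cnj (x $ j) * (cnj (A $ i $ j) * y $ i))"
    by (subst sum.swap) (simp only: mult_ac)
  also have "\<dots> = x \<bullet> (conj_transpose A *v y)"
    unfolding inner by (simp only: matrix_vector_mult_def conj_transpose_def vec_lambda_beta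
        sum_distrib_left)
  finally show ?thesis .
qed

lemma hermitian_matrix_self_adjoint:
  "hermitian_matrix A \<Longrightarrow> (A *v x) \<bullet> y = x \<bullet> (A *v y)"
  by (simp add: inner_matrix_conj_transpose hermitian_matrix_def)

lemma scaleR_matrix_vector: "(c *\<^sub>R A) *v x = c *\<^sub>R (A *v x)"
  for A :: "complex^'n^'m"
  by (simp add: vec_eq_iff matrix_vector_mult_def scaleR_sum_right)

section \<open>Inverses\<close>

lemma matrix_inv_mult_right: "invertible A \<Longrightarrow> A ** matrix_inv A = mat 1"
  unfolding invertible_def matrix_inv_def by (metis (mono_tags, lifting) someI_ex)

lemma matrix_inv_mult_left: "invertible A \<Longrightarrow> matrix_inv A ** A = mat 1"
  unfolding invertible_def matrix_inv_def by (metis (mono_tags, lifting) someI_ex)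

lemma matrix_inv_eqI:
  fixes A B :: "complex^'n^'n"
  assumes "A ** B = mat 1"
  shows "invertible A" and "matrix_inv A = B"
proof -
  show inv: "invertible A"
    using assms invertible_right_inverse by blast
  show "matrix_inv A = B"
    by (metis assms inv matrix_inv_mult_left matrix_mul_assoc matrix_mul_lid matrix_mul_rid)
qed

lemma matrix_inv_involution:
  fixes A :: "complex^'n^'n"
  assumes "invertible A"
  shows "invertible (matrix_inv A)" and "matrix_inv (matrix_inv A) = A"
  using matrix_inv_eqI[OF matrix_inv_mult_left[OF assms]] by auto

lemma hermitian_matrix_inv:
  assumes "hermitian_matrix A" and "invertible A"
  shows "hermitian_matrix (matrix_inv A)"
proof -
  have "A ** conj_transpose (matrix_inv A) = conj_transpose (matrix_inv A ** A)"
    using assms(1) by (simp add: conj_transpose_mult hermitian_matrix_def)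
  also have "\<dots> = mat 1"
    by (simp add: matrix_inv_mult_left assms(2) conj_transpose_mat_1)
  finally show ?thesis
    using matrix_inv_eqI(2) by (metis hermitian_matrix_def)
qed

lemma matrix_mult_add_right: "(A + B) ** C = A ** C + B ** C"
  for A B C :: "complex^'n^'n"
  by (simp add: vec_eq_iff matrix_matrix_mult_def algebra_simps sum.distrib)

lemma matrix_mult_diff:
  fixes A B C :: "complex^'n^'n"
  shows "A ** (B - C) = A ** B - A ** C" and "(A - B) ** C = A ** C - B ** C"
  by (simp_all add: vec_eq_iff matrix_matrix_mult_def algebra_simps sum_subtractf)

text \<open>The matrix \<open>N - F N\<^sup>-\<^sup>1 F\<close> equals both \<open>(N + F) N\<^sup>-\<^sup>1 (N - F)\<close> and
  \<open>(N - F) N\<^sup>-\<^sup>1 (N + F)\<close>.  Multiplying it by one of the two inverses therefore cancels a factor,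
  and the remaining factors add up to \<open>2 N\<close>.\<close>

lemma matrix_inv_average:
  fixes N F :: "complex^'n^'n"
  assumes N: "invertible N" and p: "invertible (N + F)" and m: "invertible (N - F)"
  shows "invertible (N - F ** matrix_inv N ** F)"
    and "matrix_inv (N - F ** matrix_inv N ** F)
          = (1/2) *\<^sub>R (matrix_inv (N + F) + matrix_inv (N - F))"
proof -
  let ?I = "matrix_inv N" and ?X = "N - F ** matrix_inv N ** F"
  have NI: "N ** ?I = mat 1" "?I ** N = mat 1"
    using N by (auto simp: matrix_inv_mult_left matrix_inv_mult_right)
  then have FI: "F ** ?I ** N = F"
    by (metis matrix_mul_assoc matrix_mul_rid)
  have X1: "?X = (N + F) ** ?I ** (N - F)" and X2: "?X = (N - F) ** ?I ** (N + F)"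
    by (simp_all add: matrix_add_ldistrib matrix_mult_add_right matrix_mult_diff NI FI)
  have "?X ** matrix_inv (N + F) = (N - F) ** ?I"
    by (subst X2) (metis matrix_inv_mult_right matrix_mul_assoc matrix_mul_rid p)
  moreover have "?X ** matrix_inv (N - F) = (N + F) ** ?I"
    by (subst X1) (metis matrix_inv_mult_right matrix_mul_assoc matrix_mul_rid m)
  ultimately have "?X ** (matrix_inv (N + F) + matrix_inv (N - F)) = 2 *\<^sub>R mat 1"
    by (simp add: matrix_add_ldistrib matrix_mult_add_right matrix_mult_diff NI scaleR_2)
  then have "?X ** ((1/2) *\<^sub>R (matrix_inv (N + F) + matrix_inv (N - F))) = mat 1"
    by (simp add: matrix_scalar_ac scalar_matrix_assoc[symmetric])
  then show "invertible ?X"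
    and "matrix_inv ?X = (1/2) *\<^sub>R (matrix_inv (N + F) + matrix_inv (N - F))"
    by (rule matrix_inv_eqI)+
qed

section \<open>Positive definite matrices\<close>

lemma pos_def_inner: "pos_def A \<Longrightarrow> x \<noteq> 0 \<Longrightarrow> 0 < x \<bullet> (A *v x)"
  by (simp add: pos_def_def Re_quad_form)

lemma pos_def_inner_nonneg: "pos_def A \<Longrightarrow> 0 \<le> x \<bullet> (A *v x)"
  by (cases "x = 0") (auto dest: pos_def_inner intro: less_imp_le)

lemma pos_def_invertible:
  assumes "pos_def A"
  shows "invertible A"
proof -
  have "x = 0" if "A *v x = 0" for x
    using pos_def_inner[OF assms, of x] that by fastforce
  then show ?thesis
    using invertible_left_inverse matrix_left_invertible_ker by blast
qed

lemma matrix_inv_vector_cancel: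
  assumes "pos_def A"
  shows "A *v (matrix_inv A *v x) = x"
  by (simp add: matrix_vector_mul_assoc matrix_inv_mult_right pos_def_invertible assms)

lemma pos_def_matrix_inv:
  assumes "pos_def A"
  shows "pos_def (matrix_inv A)"
proof -
  have "0 < x \<bullet> (matrix_inv A *v x)" if "x \<noteq> 0" for x
  proof -
    let ?y = "matrix_inv A *v x"
    have x: "A *v ?y = x"
      by (rule matrix_inv_vector_cancel[OF assms])
    with that have "?y \<noteq> 0"
      by (metis matrix_vector_mult_0_right)
    then show ?thesis
      using pos_def_inner[OF assms, of ?y] x by (simp add: inner_commute)
  qed
  then show ?thesis
    using assms hermitian_matrix_inv pos_def_invertible
    by (auto simp: pos_def_def Re_quad_form)
qed

lemma pos_def_convex:
  assumes A: "pos_def A" and B: "pos_def B" and l: "0 \<le> l" "l \<le> 1"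
  shows "pos_def ((1 - l) *\<^sub>R A + l *\<^sub>R B)"
proof -
  have "0 < (1 - l) * (x \<bullet> (A *v x)) + l * (x \<bullet> (B *v x))" if "x \<noteq> 0" for x
  proof (cases "l = 0")
    case True
    then show ?thesis using pos_def_inner[OF A that] by simp
  next
    case False
    then show ?thesis
      using pos_def_inner[OF A that] pos_def_inner[OF B that] l
      by (intro add_nonneg_pos mult_nonneg_nonneg mult_pos_pos) auto
  qed
  moreover have "hermitian_matrix ((1 - l) *\<^sub>R A + l *\<^sub>R B)"
    using A B by (simp add: pos_def_def hermitian_matrix_add hermitian_matrix_scaleR)
  ultimately show ?thesis
    by (simp add: pos_def_def Re_quad_form matrix_vector_mult_add_rdistrib
        scaleR_matrix_vector inner_add_right)
qed

text \<open>The difference of the two sides is the quadratic form of \<open>A\<close> at \<open>y - A\<^sup>-\<^sup>1 x\<close>.\<close>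

lemma inverse_form_ge:
  assumes "pos_def A"
  shows "2 * (y \<bullet> x) - y \<bullet> (A *v y) \<le> x \<bullet> (matrix_inv A *v x)"
proof -
  let ?z = "matrix_inv A *v x"
  have x: "A *v ?z = x"
    by (rule matrix_inv_vector_cancel[OF assms])
  have "?z \<bullet> (A *v y) = x \<bullet> y"
    using assms x hermitian_matrix_self_adjoint[of A ?z y] by (simp add: pos_def_def)
  moreover have "0 \<le> (y - ?z) \<bullet> (A *v (y - ?z))"
    by (rule pos_def_inner_nonneg[OF assms])
  ultimately show ?thesis
    by (simp add: matrix_vector_mult_diff_distrib inner_diff_left inner_diff_right x
        inner_commute)
qed

section \<open>Operator convexity of the inverse\<close>

lemma loewner_le_iff:
  assumes "hermitian_matrix A" and "hermitian_matrix B"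
  shows "A \<preceq>\<^sub>L B \<longleftrightarrow> (\<forall>x. x \<bullet> (A *v x) \<le> x \<bullet> (B *v x))"
  using assms
  by (simp add: loewner_le_def pos_semidef_def Re_quad_form hermitian_matrix_diff
      matrix_vector_mult_diff_rdistrib inner_diff_right)

lemma loewner_le_scaleR:
  assumes "A \<preceq>\<^sub>L B" and "0 \<le> c"
  shows "c *\<^sub>R A \<preceq>\<^sub>L c *\<^sub>R B"
  using assms
  by (simp add: loewner_le_def pos_semidef_def Re_quad_form hermitian_matrix_scaleR
      scaleR_matrix_vector flip: scaleR_diff_right)

text \<open>The lower bound \<open>inverse_form_ge\<close> is attained at \<open>y = Z\<^sup>-\<^sup>1 x\<close> for the convex combination
  \<open>Z\<close>; the same \<open>y\<close> gives lower bounds for \<open>A\<close> and \<open>B\<close>, whose weighted sum is the value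
  attained, because the bound is affine in the matrix.\<close>

lemma loewner_inverse_convex:
  assumes A: "pos_def A" and B: "pos_def B" and l: "0 \<le> l" "l \<le> 1"
  shows "matrix_inv ((1 - l) *\<^sub>R A + l *\<^sub>R B)
          \<preceq>\<^sub>L (1 - l) *\<^sub>R matrix_inv A + l *\<^sub>R matrix_inv B"
proof -
  let ?Z = "(1 - l) *\<^sub>R A + l *\<^sub>R B"
  have Z: "pos_def ?Z"
    by (rule pos_def_convex[OF assms])
  have "x \<bullet> (matrix_inv ?Z *v x)
      \<le> (1 - l) * (x \<bullet> (matrix_inv A *v x)) + l * (x \<bullet> (matrix_inv B *v x))" for x
  proof -
    define y where "y = matrix_inv ?Z *v x"
    have "y \<bullet> x = y \<bullet> (?Z *v y)"
      using matrix_inv_vector_cancel[OF Z] by (simp add: y_def)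
    also have "\<dots> = (1 - l) * (y \<bullet> (A *v y)) + l * (y \<bullet> (B *v y))"
      by (simp add: matrix_vector_mult_add_rdistrib scaleR_matrix_vector inner_add_right)
    finally have "x \<bullet> y = (1 - l) * (2 * (y \<bullet> x) - y \<bullet> (A *v y))
        + l * (2 * (y \<bullet> x) - y \<bullet> (B *v y))"
      by (simp add: algebra_simps inner_commute)
    also have "\<dots> \<le> (1 - l) * (x \<bullet> (matrix_inv A *v x)) + l * (x \<bullet> (matrix_inv B *v x))"
      using l inverse_form_ge[OF A] inverse_form_ge[OF B]
      by (intro add_mono mult_left_mono) auto
    finally show ?thesis
      by (simp add: y_def)
  qed
  moreover have "hermitian_matrix (matrix_inv ?Z)"
    "hermitian_matrix ((1 - l) *\<^sub>R matrix_inv A + l *\<^sub>R matrix_inv B)"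
    using pos_def_matrix_inv[OF A] pos_def_matrix_inv[OF B] pos_def_matrix_inv[OF Z]
    by (simp_all add: pos_def_def hermitian_matrix_add hermitian_matrix_scaleR)
  ultimately show ?thesis
    by (simp add: loewner_le_iff matrix_vector_mult_add_rdistrib scaleR_matrix_vector
        inner_add_right)
qed

section \<open>The Heinz mean as an inverse\<close>

text \<open>The parameter is \<open>u = c\<^sup>2\<close> rather than \<open>c = 1 - 2 t\<close>: the matrix is affine in \<open>u\<close>, and
  the symmetry of the Heinz mean under \<open>t \<mapsto> 1 - t\<close> is built in.\<close>

definition heinz_denominator ::
    "complex^'n^'n \<Rightarrow> complex^'n^'n \<Rightarrow> real \<Rightarrow> complex^'n^'n" where
  "heinz_denominator A B u =
     (let N = (1/2) *\<^sub>R (matrix_inv A + matrix_inv B);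
          E = (1/2) *\<^sub>R (matrix_inv A - matrix_inv B)
      in N - u *\<^sub>R (E ** matrix_inv N ** E))"

lemma heinz_denominator_affine:
  fixes A B :: "complex^'n^'n"
  shows
  "heinz_denominator A B ((1 - l) * u + l * v)
    = (1 - l) *\<^sub>R heinz_denominator A B u + l *\<^sub>R heinz_denominator A B v"
proof -
  have "N - ((1 - l) * u + l * v) *\<^sub>R W = (1 - l) *\<^sub>R (N - u *\<^sub>R W) + l *\<^sub>R (N - v *\<^sub>R W)"
    for N W :: "complex^'n^'n"
    by (simp add: scaleR_diff_left scaleR_diff_right scaleR_add_left)
  then show ?thesis
    by (simp only: heinz_denominator_def Let_def)
qed

lemma harmonic_heinz_mean_eq_inv:
  assumes A: "pos_def A" and B: "pos_def B" and t: "0 \<le> t" "t \<le> 1"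
  shows "invertible (heinz_denominator A B ((1 - 2 * t)\<^sup>2))"
    and "harmonic_heinz_mean t A B = matrix_inv (heinz_denominator A B ((1 - 2 * t)\<^sup>2))"
proof -
  define N where "N = (1/2) *\<^sub>R (matrix_inv A + matrix_inv B)"
  define F where "F = (1 - 2 * t) *\<^sub>R ((1/2) *\<^sub>R (matrix_inv A - matrix_inv B))"
  have plus: "N + F = (1 - t) *\<^sub>R matrix_inv A + t *\<^sub>R matrix_inv B"
    by (simp add: N_def F_def vec_eq_iff complex_eq_iff field_simps)
  have minus: "N - F = (1 - (1 - t)) *\<^sub>R matrix_inv A + (1 - t) *\<^sub>R matrix_inv B"
    by (simp add: N_def F_def vec_eq_iff complex_eq_iff field_simps)
  have N: "N = (1 - 1/2) *\<^sub>R matrix_inv A + (1/2) *\<^sub>R matrix_inv B"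
    by (simp add: N_def scaleR_add_right)
  have comb: "invertible ((1 - s) *\<^sub>R matrix_inv A + s *\<^sub>R matrix_inv B)"
    if "0 \<le> s" "s \<le> 1" for s
    by (intro pos_def_invertible pos_def_convex pos_def_matrix_inv A B that)
  have inv: "invertible N" "invertible (N + F)" "invertible (N - F)"
    using t unfolding plus minus unfolding N by (intro comb; simp)+
  have X: "heinz_denominator A B ((1 - 2 * t)\<^sup>2) = N - F ** matrix_inv N ** F"
    by (simp add: heinz_denominator_def Let_def N_def F_def matrix_scalar_ac
        scalar_matrix_assoc[symmetric] power2_eq_square)
  show "invertible (heinz_denominator A B ((1 - 2 * t)\<^sup>2))"
    unfolding X by (rule matrix_inv_average(1)[OF inv])
  have "harmonic_heinz_mean t A B = (1/2) *\<^sub>R (matrix_inv (N + F) + matrix_inv (N - F))"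
    unfolding harmonic_heinz_mean_def harmonic_mean_def plus minus by simp
  then show "harmonic_heinz_mean t A B = matrix_inv (heinz_denominator A B ((1 - 2 * t)\<^sup>2))"
    unfolding X by (simp add: matrix_inv_average(2)[OF inv])
qed

text \<open>At \<open>t = 0\<close> the two weighted harmonic means in the Heinz mean are \<open>A\<close> and \<open>B\<close>.\<close>

lemma harmonic_heinz_mean_0:
  assumes "pos_def A" and "pos_def B"
  shows "harmonic_heinz_mean 0 A B = arithmetic_mean A B"
  using assms
  by (simp add: harmonic_heinz_mean_def harmonic_mean_def arithmetic_mean_def
      matrix_inv_involution(2) pos_def_invertible)

text \<open>By affinity it is enough to look at the two endpoints: the denominator is the inverse of
  the arithmetic mean at \<open>u = 1\<close>, and the average of the two inverses at \<open>u = 0\<close>.\<close>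

lemma heinz_denominator_pos_def:
  assumes A: "pos_def A" and B: "pos_def B" and u: "0 \<le> u" "u \<le> 1"
  shows "pos_def (heinz_denominator A B u)"
proof -
  let ?X = "heinz_denominator A B"
  have avg: "pos_def ((1/2) *\<^sub>R (C + D))" if "pos_def C" "pos_def D" for C D :: "complex^'n^'n"
    using pos_def_convex[OF that, of "1/2"] by (simp add: scaleR_add_right)
  have "invertible (?X 1)" and "arithmetic_mean A B = matrix_inv (?X 1)"
    using harmonic_heinz_mean_eq_inv[OF A B, of 0] harmonic_heinz_mean_0[OF A B] by simp_all
  then have "?X 1 = matrix_inv (arithmetic_mean A B)"
    by (simp add: matrix_inv_involution)
  then have 1: "pos_def (?X 1)"
    unfolding arithmetic_mean_def by (simp only: pos_def_matrix_inv avg A B)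
  have 0: "pos_def (?X 0)"
    by (simp add: heinz_denominator_def avg pos_def_matrix_inv A B)
  show ?thesis
    using pos_def_convex[OF 0 1 u] heinz_denominator_affine[of A B u 0 1] by simp
qed

lemma heinz_inverse_convex:
  assumes A: "pos_def A" and B: "pos_def B"
    and v: "0 \<le> v" "v \<le> 1" and l: "0 \<le> l" "l \<le> 1" and u: "u = (1 - l) + l * v"
  shows "matrix_inv (heinz_denominator A B u)
          \<preceq>\<^sub>L (1 - l) *\<^sub>R arithmetic_mean A B + l *\<^sub>R matrix_inv (heinz_denominator A B v)"
  using loewner_inverse_convex[OF heinz_denominator_pos_def[OF A B, of 1]
      heinz_denominator_pos_def[OF A B v] l]
    heinz_denominator_affine[of A B l 1 v]
    harmonic_heinz_mean_eq_inv(2)[OF A B, of 0] harmonic_heinz_mean_0[OF A B] u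
  by simp

section \<open>Comparison of Heinz means\<close>

theorem theorem3p2:
  fixes A B :: "complex^'n^'n" and \<tau> t :: real
  assumes "pos_def A" and "pos_def B"
    and "0 < \<tau>" and "\<tau> < 1"
    and "0 \<le> t" and "t \<le> 1"
  shows "(t \<le> weight_min \<tau> \<or> t \<ge> weight_max \<tau> \<longrightarrow>
      harmonic_heinz_mean t A B
        + (t * (1 - t) / (\<tau> * (1 - \<tau>))) *\<^sub>R (arithmetic_mean A B - harmonic_heinz_mean \<tau> A B)
      \<preceq>\<^sub>L arithmetic_mean A B) \<and>
    (weight_min \<tau> \<le> t \<and> t \<le> weight_max \<tau> \<longrightarrow>
      arithmetic_mean A B
      \<preceq>\<^sub>L harmonic_heinz_mean t A B
        + (t * (1 - t) / (\<tau> * (1 - \<tau>))) *\<^sub>R (arithmetic_mean A B - harmonic_heinz_mean \<tau> A B))"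
proof -
  define u where "u = (1 - 2 * t)\<^sup>2"
  define v where "v = (1 - 2 * \<tau>)\<^sup>2"
  define l where "l = t * (1 - t) / (\<tau> * (1 - \<tau>))"
  let ?K = "\<lambda>u. matrix_inv (heinz_denominator A B u)" and ?M = "arithmetic_mean A B"
  have Kt: "harmonic_heinz_mean t A B = ?K u" and K\<tau>: "harmonic_heinz_mean \<tau> A B = ?K v"
    using harmonic_heinz_mean_eq_inv(2)[OF assms(1,2)] assms by (simp_all add: u_def v_def)
  have \<tau>: "0 < \<tau> * (1 - \<tau>)" and t: "0 \<le> t * (1 - t)"
    using assms by simp_all
  have u1: "1 - u = 4 * (t * (1 - t))" and v1: "1 - v = 4 * (\<tau> * (1 - \<tau>))"
    by (simp_all add: u_def v_def power2_eq_square algebra_simps)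
  have uv: "0 \<le> u" "u \<le> 1" "0 \<le> v" "v \<le> 1"
    using u1 v1 t \<tau> by (simp_all add: u_def v_def)
  have l0: "0 \<le> l"
    using t \<tau> by (simp add: l_def)
  have "l * (\<tau> * (1 - \<tau>)) = t * (1 - t)"
    using \<tau> eq_divide_eq[of l] l_def by auto
  then have "l * (1 - v) = 1 - u"
    by (simp add: u1 v1)
  then have u_eq: "u = (1 - l) + l * v"
    by (simp add: algebra_simps)
  (* this product has the sign of u - v *)
  have factor: "\<tau> * (1 - \<tau>) - t * (1 - t) = (t - \<tau>) * (t - (1 - \<tau>))"
    by (simp add: algebra_simps)
  have 1: "?K u + l *\<^sub>R (?M - ?K v) \<preceq>\<^sub>L ?M" if "t \<le> weight_min \<tau> \<or> t \<ge> weight_max \<tau>"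
  proof -
    have "0 \<le> (t - \<tau>) * (t - (1 - \<tau>))"
      using that by (auto simp: weight_min_def weight_max_def zero_le_mult_iff)
    then have "l \<le> 1"
      using \<tau> factor by (simp add: l_def)
    from heinz_inverse_convex[OF assms(1,2) uv(3,4) l0 this u_eq] show ?thesis
      by (simp add: loewner_le_def algebra_simps)
  qed
  have 2: "?M \<preceq>\<^sub>L ?K u + l *\<^sub>R (?M - ?K v)" if "weight_min \<tau> \<le> t \<and> t \<le> weight_max \<tau>"
  proof -
    have "(t - \<tau>) * (t - (1 - \<tau>)) \<le> 0"
      using that by (auto simp: weight_min_def weight_max_def mult_le_0_iff min_def max_def
          split: if_splits)
    then have l1: "1 \<le> l"
      using \<tau> factor by (simp add: l_def)
    (* solving the relation u = (1 - l) + l v for v gives the weights for interpolation at v *)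
    have "v = (1 - 1/l) + 1/l * u"
      using u_eq l1 by (simp add: field_simps)
    from heinz_inverse_convex[OF assms(1,2) uv(1,2) _ _ this] l1
    have "?K v \<preceq>\<^sub>L (1 - 1/l) *\<^sub>R ?M + (1/l) *\<^sub>R ?K u"
      by simp
    from loewner_le_scaleR[OF this l0] have "l *\<^sub>R ?K v \<preceq>\<^sub>L (l - 1) *\<^sub>R ?M + ?K u"
      using l1 by (simp add: scaleR_add_right right_diff_distrib)
    then show ?thesis
      by (simp add: loewner_le_def algebra_simps)
  qed
  show ?thesis
    using 1 2 by (simp add: Kt K\<tau> flip: l_def)
qed

end
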